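(* Let $q$ be a prime power, let $d$ be a positive integer, let $k \in \{1,2,\ldots,d-1\}$, and let $E \subset \mathbb{F}_q^d$. If $|E| > 30q^k$, then there is a point $y \in E$ such that $|\pi^y(E)| \geq q^k/4$.
   Context: $\mathbb{F}_q$ denotes the finite field with $q$ elements and $\mathbb{F}_q^d$ the $d$-dimensional vector space over it. A line is an affine line (a translate of a $1$-dimensional linear subspace of $\mathbb{F}_q^d$). For a point $y \in \mathbb{F}_q^d$, the radial projection $\pi^y$ maps each point $x \in \mathbb{F}_q^d \setminus \{y\}$ to the unique line containing $x$ and $y$. For a set $E \subset \mathbb{F}_q^d$, $\pi^y(E)$ denotes the set of lines $\{\pi^y(x) : x \in E \setminus \{y\}\}$, and $|\pi^y(E)|$ is the number of distinct lines in this set (i.e. the number of lines through $y$ that contain at least one point of $E$ other than $y$). *)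

theory Defs
  imports "HOL-Analysis.Cartesian_Space" "HOL-Number_Theory.Prime_Powers"
begin

definition affine_line :: "('a::field ^ 'd::finite) set \<Rightarrow> bool" where
  "affine_line L \<longleftrightarrow> (\<exists>S p. vec.subspace S \<and> vec.dim S = 1 \<and> L = (\<lambda>v. p + v) ` S)"

text \<open>Meaningful only for \<^term>\<open>x \<noteq> y\<close>; see \<open>affine_line_ex1\<close> below.\<close>

definition radial_proj :: "'a::field ^ 'd::finite \<Rightarrow> 'a ^ 'd \<Rightarrow> ('a ^ 'd) set" where
  "radial_proj y x = (THE L. affine_line L \<and> x \<in> L \<and> y \<in> L)"

definition radial_image :: "'a::field ^ 'd::finite \<Rightarrow> ('a ^ 'd) set \<Rightarrow> ('a ^ 'd) set set" where
  "radial_image y E = radial_proj y ` (E - {y})"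

lemma affine_line_through:
  fixes x y :: "'a::field ^ 'd::finite"
  assumes "x \<noteq> y" "affine_line L" "x \<in> L" "y \<in> L"
  shows "L = (\<lambda>v. y + v) ` vec.span {x - y}"
proof -
  obtain S p where S: "vec.subspace S" "vec.dim S = 1" and L: "L = (\<lambda>v. p + v) ` S"
    using assms(2) unfolding affine_line_def by blast
  obtain a b where a: "a \<in> S" "x = p + a" and b: "b \<in> S" "y = p + b"
    using assms(3,4) L by auto
  have xy: "x - y \<in> S"
    using a b vec.subspace_diff[OF S(1)] by simp
  have ind: "vec.independent {x - y}"
    using assms(1) by simp
  have "S \<subseteq> vec.span {x - y}"
    by (rule vec.card_ge_dim_independent) (use xy ind S(2) in auto)
  moreover have "vec.span {x - y} \<subseteq> S"
    using xy S(1) by (simp add: vec.span_minimal)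
  ultimately have Seq: "S = vec.span {x - y}" by blast
  have "(\<lambda>v. p + v) ` S = (\<lambda>v. y + v) ` S"
  proof (intro subset_antisym subsetI)
    fix z assume "z \<in> (\<lambda>v. p + v) ` S"
    then obtain v where "v \<in> S" "z = p + v" by auto
    then show "z \<in> (\<lambda>v. y + v) ` S"
      using b vec.subspace_diff[OF S(1), of v b] by (intro image_eqI[of _ _ "v - b"]) auto
  next
    fix z assume "z \<in> (\<lambda>v. y + v) ` S"
    then obtain v where "v \<in> S" "z = y + v" by auto
    then show "z \<in> (\<lambda>v. p + v) ` S"
      using b vec.subspace_add[OF S(1), of b v] by (intro image_eqI[of _ _ "b + v"]) (auto simp: add.assoc)
  qed
  then show ?thesis using L Seq by simp
qed

lemma affine_line_ex1:
  fixes x y :: "'a::field ^ 'd::finite"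
  assumes "x \<noteq> y"
  shows "\<exists>!L. affine_line L \<and> x \<in> L \<and> y \<in> L"
proof (rule ex_ex1I)
  let ?L = "(\<lambda>v. y + v) ` vec.span {x - y}"
  have "vec.dim (vec.span {x - y}) = 1"
    using assms by (simp add: vec.dim_eq_card_independent)
  then have "affine_line ?L"
    unfolding affine_line_def using vec.subspace_span by blast
  moreover have "x \<in> ?L"
    by (rule image_eqI[of _ _ "x - y"]) (auto intro: vec.span_base)
  moreover have "y \<in> ?L"
    by (rule image_eqI[of _ _ 0]) (auto intro: vec.span_zero)
  ultimately show "\<exists>L. affine_line L \<and> x \<in> L \<and> y \<in> L" by blast
next
  fix L M
  assume "affine_line L \<and> x \<in> L \<and> y \<in> L" "affine_line M \<and> x \<in> M \<and> y \<in> M"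
  then show "L = M" using affine_line_through[OF assms] by metis
qed

end

theory Submission
  imports Defs
begin

text \<open>
  A linear map sends lines through a point to lines or points, so it cannot increase the size of a
  radial projection. A random linear map to a space of dimension \<open>k + 1\<close> has few collisions
  on a subset of \<open>E\<close> with \<open>4q\<^sup>k\<close> points when \<open>q \<ge> 16\<close>, hence has an image with at
  least \<open>3q\<^sup>k\<close> points. If every point of the image saw fewer than a quarter of the directions,
  most lines through it would be tangent, meaning that they meet the image only there; but for each
  direction the tangent lines are disjoint, which leaves at most \<open>q\<^sup>k\<close> of them. For
  \<open>q < 16\<close> it is enough that a line has \<open>q\<close> points.
\<close>

section \<open>Directions and coordinate subspaces\<close>

text \<open>A direction is represented by all its nonzero vectors instead of a projective point, so
  that directions can be counted inside a vector space.\<close>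

definition secant_directions :: "'a::field ^ 'n::finite \<Rightarrow> ('a ^ 'n) set \<Rightarrow> ('a ^ 'n) set" where
  "secant_directions y F = {c *s (x - y) | c x. c \<noteq> 0 \<and> x \<in> F \<and> x \<noteq> y}"

text \<open>This stands in for a space of dimension \<open>card I\<close>, as that dimension is a
  value and not a type. Requiring only a zero of the entries lets them be scalars or whole rows, so
  the same definition gives the matrices with image in such a subspace.\<close>

definition coordinate_subspace :: "'n::finite set \<Rightarrow> ('b::zero ^ 'n) set" where
  "coordinate_subspace I = {x. \<forall>i. i \<notin> I \<longrightarrow> x $ i = 0}"

lemma subspace_coordinate_subspace:
  "vec.subspace (coordinate_subspace I :: ('a::field ^ 'n::finite) set)"
  by (auto simp: vec.subspace_def coordinate_subspace_def)

lemma card_coordinate_subspace_restricted: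
  fixes S :: "'b::{zero,finite} set" and I :: "'n::finite set"
  shows "card {x \<in> coordinate_subspace I. \<forall>i\<in>I. x $ i \<in> S} = card S ^ card I"
proof -
  let ?B = "\<lambda>i. if i \<in> I then S else {0}"
  have "{x \<in> coordinate_subspace I. \<forall>i\<in>I. x $ i \<in> S} = vec_lambda ` (PiE UNIV ?B)"
  proof (intro subset_antisym subsetI)
    fix x :: "'b ^ 'n"
    assume "x \<in> {x \<in> coordinate_subspace I. \<forall>i\<in>I. x $ i \<in> S}"
    then have "vec_nth x \<in> PiE UNIV ?B"
      by (auto simp: coordinate_subspace_def)
    then show "x \<in> vec_lambda ` (PiE UNIV ?B)"
      by (intro image_eqI[of _ _ "vec_nth x"]) auto
  next
    fix x :: "'b ^ 'n"
    assume "x \<in> vec_lambda ` (PiE UNIV ?B)"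
    then obtain f where f: "\<And>i. f i \<in> ?B i" and x: "x = vec_lambda f"
      by auto
    show "x \<in> {x \<in> coordinate_subspace I. \<forall>i\<in>I. x $ i \<in> S}"
    proof (intro CollectI conjI ballI)
      show "x \<in> coordinate_subspace I"
        unfolding coordinate_subspace_def
      proof (intro CollectI allI impI)
        fix i assume "i \<notin> I"
        then show "x $ i = 0" using f[of i] by (simp add: x)
      qed
      show "x $ i \<in> S" if "i \<in> I" for i
        using f[of i] that by (simp add: x)
    qed
  qed
  moreover have "inj_on vec_lambda (PiE UNIV ?B)"
    by (auto simp: inj_on_def vec_lambda_inject)
  ultimately have "card {x \<in> coordinate_subspace I. \<forall>i\<in>I. x $ i \<in> S} = card (PiE UNIV ?B)"
    by (simp add: card_image)
  also have "\<dots> = (\<Prod>i\<in>UNIV. if i \<in> I then card S else 1)"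
    by (subst card_PiE) (auto intro!: prod.cong)
  also have "\<dots> = card S ^ card I"
    by (simp add: prod.If_cases)
  finally show ?thesis .
qed

lemma card_coordinate_subspace:
  fixes I :: "'n::finite set"
  shows "card (coordinate_subspace I :: ('b::{zero,finite} ^ 'n) set) = CARD('b) ^ card I"
  using card_coordinate_subspace_restricted[of I "UNIV :: 'b set"] by simp

section \<open>Linear maps with few collisions\<close>

text \<open>If \<open>w $ l\<close> is nonzero, the translates of the hyperplane by the multiples of
  the \<open>l\<close>-th unit vector are pairwise disjoint, one for each scalar.\<close>

lemma card_hyperplane_le:
  fixes w :: "'a::{field,finite} ^ 'n::finite"
  assumes "w \<noteq> 0"
  shows "CARD('a) * card {a. (\<Sum>j\<in>UNIV. a $ j * w $ j) = 0} \<le> CARD('a ^ 'n)"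
proof -
  let ?H = "{a. (\<Sum>j\<in>UNIV. a $ j * w $ j) = 0}"
  obtain l where l: "w $ l \<noteq> 0"
    using assms by (auto simp: vec_eq_iff)
  let ?f = "\<lambda>(c :: 'a, a). a + c *s axis l 1"
  have functional: "(\<Sum>j\<in>UNIV. (a + c *s axis l 1) $ j * w $ j) = c * w $ l"
    if "a \<in> ?H" for a c
  proof -
    have "(\<Sum>j\<in>UNIV. (a + c *s axis l 1) $ j * w $ j)
        = (\<Sum>j\<in>UNIV. a $ j * w $ j) + (\<Sum>j\<in>UNIV. if j = l then c * w $ j else 0)"
      unfolding sum.distrib[symmetric]
      by (rule sum.cong) (auto simp: axis_def algebra_simps)
    then show ?thesis using that by simp
  qed
  have "inj_on ?f (UNIV \<times> ?H)"
  proof (rule inj_onI, clarify)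
    fix c a c' a'
    assume a: "(\<Sum>j\<in>UNIV. a $ j * w $ j) = 0" "(\<Sum>j\<in>UNIV. a' $ j * w $ j) = 0"
      and eq: "a + c *s axis l 1 = a' + c' *s axis l 1"
    have "c * w $ l = c' * w $ l"
      using functional[of a c] functional[of a' c'] a eq by simp
    then have "c = c'" using l by simp
    then show "c = c' \<and> a = a'" using eq by simp
  qed
  then have "card ((UNIV :: 'a set) \<times> ?H) \<le> CARD('a ^ 'n)"
    by (intro card_inj_on_le[of ?f]) auto
  then show ?thesis by (simp add: card_cartesian_product)
qed

text \<open>The rows in \<open>I\<close> are free and each must lie in the hyperplane orthogonal to
  \<open>w\<close>. So a uniformly random matrix kills \<open>w\<close> with probability at most
  \<open>CARD('a)\<close> to the power \<open>- card I\<close>.\<close>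

lemma card_matrices_annihilating_le:
  fixes w :: "'a::{field,finite} ^ 'n::finite" and I :: "'m::finite set"
  assumes "w \<noteq> 0"
  shows "CARD('a) ^ card I * card {A \<in> coordinate_subspace I. A *v w = 0}
    \<le> card (coordinate_subspace I :: ('a ^ 'n ^ 'm) set)"
proof -
  let ?H = "{a. (\<Sum>j\<in>UNIV. a $ j * w $ j) = 0}"
  have "{A \<in> coordinate_subspace I. A *v w = 0} \<subseteq>
    {A \<in> coordinate_subspace I. \<forall>i\<in>I. A $ i \<in> ?H}"
    by (auto simp: matrix_vector_mult_def vec_eq_iff)
  then have "card {A \<in> coordinate_subspace I. A *v w = 0} \<le> card ?H ^ card I"
    using card_mono[of "{A \<in> coordinate_subspace I. \<forall>i\<in>I. A $ i \<in> ?H}"]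
    by (simp only: card_coordinate_subspace_restricted finite)
  then have "CARD('a) ^ card I * card {A \<in> coordinate_subspace I. A *v w = 0}
      \<le> (CARD('a) * card ?H) ^ card I"
    by (simp add: power_mult_distrib)
  also have "\<dots> \<le> CARD('a ^ 'n) ^ card I"
    by (rule power_mono[OF card_hyperplane_le[OF assms]]) simp
  finally show ?thesis by (simp only: card_coordinate_subspace)
qed

text \<open>Keep one representative per fibre; every other point \<open>x\<close> of
  \<open>E\<close> yields the colliding pair \<open>(x, r x)\<close>.\<close>

lemma card_diff_card_image_le:
  assumes "finite E"
  shows "card E - card (f ` E) \<le> card {(x, y) \<in> E \<times> E. x \<noteq> y \<and> f x = f y}"
proof -
  obtain R where R: "R \<subseteq> E" "inj_on f R" "f ` E = f ` R"
    using subset_image_inj[of "f ` E" f E] by auto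
  define r where "r x = (SOME y. y \<in> R \<and> f y = f x)" for x
  have r: "r x \<in> R \<and> f (r x) = f x" if "x \<in> E" for x
  proof -
    have "f x \<in> f ` R" using that R(3) by blast
    then show ?thesis unfolding r_def by (intro someI_ex[of "\<lambda>y. y \<in> R \<and> f y = f x"]) auto
  qed
  have "card E - card (f ` E) = card (E - R)"
    using R assms by (simp add: card_image card_Diff_subset finite_subset)
  also have "\<dots> \<le> card {(x, y) \<in> E \<times> E. x \<noteq> y \<and> f x = f y}"
  proof (rule card_inj_on_le[of "\<lambda>x. (x, r x)"])
    show "inj_on (\<lambda>x. (x, r x)) (E - R)" by (auto simp: inj_on_def)
    show "(\<lambda>x. (x, r x)) ` (E - R) \<subseteq> {(x, y) \<in> E \<times> E. x \<noteq> y \<and> f x = f y}"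
      using r R(1) by fastforce
    show "finite {(x, y) \<in> E \<times> E. x \<noteq> y \<and> f x = f y}"
      by (rule finite_subset[of _ "E \<times> E"]) (use assms in auto)
  qed
  finally show ?thesis .
qed

text \<open>First moment method: a pair of distinct points collides exactly when the matrix kills
  their difference. Hence the average number of colliding ordered pairs is at most
  \<open>card E ^ 2\<close> divided by \<open>CARD('a) ^ card I\<close>, and some matrix does no
  worse.\<close>

lemma exists_matrix_few_collisions:
  fixes E :: "('a::{field,finite} ^ 'n::finite) set" and I :: "'m::finite set"
  shows "\<exists>A \<in> coordinate_subspace I :: ('a ^ 'n ^ 'm) set.
    CARD('a) ^ card I * (card E - card ((*v) A ` E)) \<le> card E ^ 2"
proof (rule ccontr)
  let ?M = "coordinate_subspace I :: ('a ^ 'n ^ 'm) set"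
  let ?Q = "CARD('a) ^ card I"
  let ?C = "\<lambda>A :: 'a ^ 'n ^ 'm. {(x, y) \<in> E \<times> E. x \<noteq> y \<and> A *v x = A *v y}"
  let ?P = "{(x, y) \<in> E \<times> E. x \<noteq> y}"
  assume "\<not> ?thesis"
  then have "card E ^ 2 < ?Q * (card E - card ((*v) A ` E))" if "A \<in> ?M" for A
    using that by force
  moreover have "?Q * (card E - card ((*v) A ` E)) \<le> ?Q * card (?C A)" for A
    by (intro mult_left_mono card_diff_card_image_le) auto
  ultimately have many: "card E ^ 2 < ?Q * card (?C A)" if "A \<in> ?M" for A
    using that by (meson less_le_trans)
  \<comment> \<open>Summing strict inequalities stays strict only over a nonempty set.\<close>
  have "0 \<in> ?M" by (simp add: coordinate_subspace_def)
  then have "card ?M * card E ^ 2 < (\<Sum>A\<in>?M. ?Q * card (?C A))"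
    using sum_strict_mono[of ?M "\<lambda>_. card E ^ 2" "\<lambda>A. ?Q * card (?C A)"] many by auto
  also have "\<dots> = ?Q * (\<Sum>A\<in>?M. card {p \<in> ?P. A *v fst p = A *v snd p})"
    by (auto simp: sum_distrib_left intro!: sum.cong arg_cong[of _ _ card])
  also have "(\<Sum>A\<in>?M. card {p \<in> ?P. A *v fst p = A *v snd p})
      = (\<Sum>p\<in>?P. card {A \<in> ?M. A *v fst p = A *v snd p})"
    by (rule sum_multicount_gen) auto
  also have "?Q * \<dots> = (\<Sum>p\<in>?P. ?Q * card {A \<in> ?M. A *v (fst p - snd p) = 0})"
    by (simp add: sum_distrib_left matrix_vector_mult_diff_distrib)
  also have "\<dots> \<le> (\<Sum>p\<in>?P. card ?M)"
    by (intro sum_mono card_matrices_annihilating_le) auto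
  also have "\<dots> = card ?P * card ?M" by simp
  also have "card ?P \<le> card (E \<times> E)"
    by (intro card_mono) auto
  also have "card (E \<times> E) * card ?M = card ?M * card E ^ 2"
    by (simp add: card_cartesian_product power2_eq_square)
  finally show False by simp
qed

section \<open>Counting tangent lines\<close>

text \<open>The lines in direction \<open>v\<close> through these points are disjoint, since a line
  shared by two points of \<open>F\<close> would be secant. Each has \<open>CARD('a)\<close> points,
  all in \<open>V\<close>.\<close>

lemma card_tangent_points_le:
  fixes V F :: "('a::{field,finite} ^ 'n::finite) set"
  assumes V: "vec.subspace V" "F \<subseteq> V" and v: "v \<in> V" "v \<noteq> 0"
  shows "CARD('a) * card {y \<in> F. v \<notin> secant_directions y F} \<le> card V"
proof -
  let ?T = "{y \<in> F. v \<notin> secant_directions y F}"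
  let ?f = "\<lambda>(c, y). y + c *s v"
  have "inj_on ?f (UNIV \<times> ?T)"
  proof (rule inj_onI, clarify)
    fix c y c' y'
    assume y: "y \<in> F" "v \<notin> secant_directions y F" "y' \<in> F" and eq: "y + c *s v = y' + c' *s v"
    then have diff: "y' - y = (c - c') *s v"
      by (simp add: vector_sub_rdistrib algebra_simps)
    have "c = c'"
    proof (rule ccontr)
      assume "c \<noteq> c'"
      then have "v = inverse (c - c') *s (y' - y)" "y' \<noteq> y"
        using diff v(2) by (auto simp: vector_smult_assoc)
      then have "v \<in> secant_directions y F"
        using y \<open>c \<noteq> c'\<close> unfolding secant_directions_def
        by (intro CollectI exI[of _ "inverse (c - c')"] exI[of _ y']) auto
      then show False using y by simp
    qed
    then show "c = c' \<and> y = y'" using eq by simp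
  qed
  moreover have "?f ` (UNIV \<times> ?T) \<subseteq> V"
    using V v(1) by (auto intro!: vec.subspace_add vec.subspace_scale)
  ultimately have "card ((UNIV :: 'a set) \<times> ?T) \<le> card V"
    by (intro card_inj_on_le[of ?f]) auto
  then show ?thesis by (simp add: card_cartesian_product)
qed

text \<open>Otherwise each point of \<open>F\<close> has at least \<open>card V / 2\<close> tangent
  vectors. Counting pairs of a point and a tangent vector in both ways then gives
  \<open>CARD('a) * card F \<le> 2 * card V\<close>, against the factor 3 assumed.\<close>

lemma exists_many_secant_directions:
  fixes V F :: "('a::{field,finite} ^ 'n::finite) set"
  assumes V: "vec.subspace V" "F \<subseteq> V" and large: "4 \<le> card V" "3 * card V \<le> CARD('a) * card F"
  shows "\<exists>y\<in>F. card V \<le> 4 * card (secant_directions y F)"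
proof (rule ccontr)
  let ?D = "\<lambda>y. secant_directions y F"
  assume "\<not> ?thesis"
  then have few: "4 * card (?D y) \<le> card V" if "y \<in> F" for y
    using that by force
  have "card V \<le> 2 * card {v \<in> V - {0}. v \<notin> ?D y}" if y: "y \<in> F" for y
  proof -
    have "V \<subseteq> insert 0 ({v \<in> V - {0}. v \<notin> ?D y} \<union> ?D y)" by auto
    then have "card V \<le> card (insert 0 ({v \<in> V - {0}. v \<notin> ?D y} \<union> ?D y))"
      by (intro card_mono) auto
    also have "\<dots> \<le> Suc (card ({v \<in> V - {0}. v \<notin> ?D y} \<union> ?D y))"
      by (rule card_insert_le_m1) auto
    also have "\<dots> \<le> Suc (card {v \<in> V - {0}. v \<notin> ?D y} + card (?D y))"
      using card_Un_le by auto
    \<comment> \<open>Removing zero and at most a quarter of \<open>V\<close> leaves at least half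
      of it precisely because \<open>card V\<close> is at least 4.\<close>
    finally show ?thesis using few[OF y] large(1) by linarith
  qed
  then have "card F * card V \<le> 2 * (\<Sum>y\<in>F. card {v \<in> V - {0}. v \<notin> ?D y})"
    using sum_mono[of F "\<lambda>_. card V" "\<lambda>y. 2 * card {v \<in> V - {0}. v \<notin> ?D y}"]
    by (simp add: sum_distrib_left)
  also have "(\<Sum>y\<in>F. card {v \<in> V - {0}. v \<notin> ?D y})
      = (\<Sum>v\<in>V - {0}. card {y \<in> F. v \<notin> ?D y})"
    by (rule sum_multicount_gen) auto
  finally have "CARD('a) * (card F * card V)
      \<le> CARD('a) * (2 * (\<Sum>v\<in>V - {0}. card {y \<in> F. v \<notin> ?D y}))"
    by (rule mult_left_mono) simp
  also have "\<dots> = 2 * (\<Sum>v\<in>V - {0}. CARD('a) * card {y \<in> F. v \<notin> ?D y})"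
    by (simp add: sum_distrib_left mult_ac)
  also have "\<dots> \<le> 2 * (\<Sum>v\<in>V - {0}. card V)"
    by (intro mult_left_mono sum_mono card_tangent_points_le V) auto
  also have "\<dots> \<le> 2 * (card V * card V)"
    by (simp add: card_Diff1_le)
  finally have "CARD('a) * card F * card V \<le> 2 * card V * card V"
    by (simp only: mult.assoc)
  then have "CARD('a) * card F \<le> 2 * card V"
    using large(1) by simp
  then show False using large by linarith
qed

section \<open>Radial projections under linear maps\<close>

lemma radial_proj_eq:
  assumes "x \<noteq> y"
  shows "radial_proj y x = (\<lambda>v. y + v) ` vec.span {x - y}"
proof -
  have "affine_line (radial_proj y x) \<and> x \<in> radial_proj y x \<and> y \<in> radial_proj y x"
    unfolding radial_proj_def by (rule theI'[OF affine_line_ex1[OF assms]])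
  then show ?thesis using affine_line_through[OF assms] by blast
qed

lemma radial_proj_eqD:
  assumes "x \<noteq> y" "z \<noteq> y" "radial_proj y x = radial_proj y z"
  obtains c where "x - y = c *s (z - y)"
proof -
  have "(\<lambda>v. y + v) ` vec.span {x - y} = (\<lambda>v. y + v) ` vec.span {z - y}"
    using assms by (simp add: radial_proj_eq)
  then have "vec.span {x - y} = vec.span {z - y}"
    by (subst (asm) inj_image_eq_iff) auto
  moreover have "x - y \<in> vec.span {x - y}"
    by (rule vec.span_base) simp
  ultimately show ?thesis
    using that by (auto simp: vec.span_singleton)
qed

text \<open>Fix a point \<open>r L\<close> of \<open>E\<close> on each line \<open>L\<close> through
  \<open>y\<close>. By linearity every secant vector of the image at \<open>A *v y\<close> is a
  multiple of the image of some \<open>r L - y\<close>, so a scalar and a line determine it.\<close>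

lemma card_secant_directions_image_le:
  fixes E :: "('a::{field,finite} ^ 'n::finite) set" and A :: "'a ^ 'n ^ 'm::finite"
  shows "card (secant_directions (A *v y) ((*v) A ` E)) \<le> CARD('a) * card (radial_image y E)"
proof -
  define r where "r L = (SOME x. x \<in> E - {y} \<and> radial_proj y x = L)" for L
  have "secant_directions (A *v y) ((*v) A ` E)
      \<subseteq> (\<lambda>(c, L). c *s (A *v (r L - y))) ` (UNIV \<times> radial_image y E)"
  proof
    fix v assume "v \<in> secant_directions (A *v y) ((*v) A ` E)"
    then obtain c x where x: "x \<in> E" "x \<noteq> y" and v: "v = c *s (A *v x - A *v y)"
      unfolding secant_directions_def by auto
    let ?L = "radial_proj y x"
    have "r ?L \<in> E - {y} \<and> radial_proj y (r ?L) = ?L"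
      unfolding r_def by (rule someI_ex) (use x in auto)
    then obtain b where b: "x - y = b *s (r ?L - y)"
      using radial_proj_eqD[of x y "r ?L"] x by auto
    have "v = (c * b) *s (A *v (r ?L - y))"
      unfolding v matrix_vector_mult_diff_distrib[symmetric] b
      by (simp add: vector_scalar_commute[symmetric] vector_smult_assoc)
    moreover have "?L \<in> radial_image y E"
      using x by (auto simp: radial_image_def)
    ultimately show "v \<in> (\<lambda>(c, L). c *s (A *v (r L - y))) ` (UNIV \<times> radial_image y E)"
      by (intro image_eqI[of _ _ "(c * b, ?L)"]) auto
  qed
  then have "card (secant_directions (A *v y) ((*v) A ` E))
      \<le> card ((UNIV :: 'a set) \<times> radial_image y E)"
    by (rule surj_card_le[rotated]) simp
  then show ?thesis by (simp add: card_cartesian_product)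
qed

text \<open>The differences \<open>x - y\<close> are distinct secant vectors, so the identity matrix
  in the previous bound suffices; the successor accounts for \<open>y\<close> itself.\<close>

lemma card_le_radial_image:
  fixes E :: "('a::{field,finite} ^ 'n::finite) set"
  shows "card E \<le> Suc (CARD('a) * card (radial_image y E))"
proof -
  have "card E \<le> Suc (card (E - {y}))"
    using card_insert_le[of E y] by (simp add: card.insert_remove)
  also have "card (E - {y}) = card ((\<lambda>x. x - y) ` (E - {y}))"
    by (simp add: card_image inj_on_def)
  also have "\<dots> \<le> card (secant_directions y E)"
  proof (intro card_mono subsetI)
    fix v assume "v \<in> (\<lambda>x. x - y) ` (E - {y})"
    then obtain x where "x \<in> E" "x \<noteq> y" "v = x - y" by auto
    then show "v \<in> secant_directions y E"
      unfolding secant_directions_def by (intro CollectI exI[of _ 1] exI[of _ x]) simp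
  qed simp
  also have "\<dots> \<le> CARD('a) * card (radial_image y E)"
    using card_secant_directions_image_le[of "mat 1" y E] by simp
  finally show ?thesis by simp
qed

theorem theorem1p3:
  fixes E :: "('a::{field,finite} ^ 'd::finite) set" and q d k :: nat
  assumes "primepow q" and "CARD('a) = q" and "CARD('d) = d"
    and "k \<in> {1..d - 1}"
    and "card E > 30 * q ^ k"
  shows "\<exists>y\<in>E. real (card (radial_image y E)) \<ge> real q ^ k / 4"
proof -
  have q: "q \<ge> 2" using assms(1) primepow_gt_Suc_0 by fastforce
  have "\<exists>y\<in>E. q ^ k \<le> 4 * card (radial_image y E)"
  proof (cases "q < 16")
    case True
    have "E \<noteq> {}" using assms(5) by auto
    then obtain y where y: "y \<in> E" by blast
    \<comment> \<open>The strict inequality in the hypothesis on \<open>card E\<close> absorbs the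
      successor.\<close>
    have "30 * q ^ k \<le> q * card (radial_image y E)"
      using card_le_radial_image[of E y] assms(5) unfolding assms(2) by linarith
    also have "\<dots> \<le> 16 * card (radial_image y E)"
      using True by (intro mult_right_mono) auto
    finally show ?thesis using y by (intro bexI[of _ y]) auto
  next
    case False
    have "Suc k \<le> CARD('d)"
      using assms(3,4) by auto
    then obtain I :: "'d set" where I: "card I = Suc k"
      by (rule obtain_subset_with_card_n)
    \<comment> \<open>With \<open>4 * q ^ k\<close> points and \<open>q ^ (k + 1)\<close> as the
      collision denominator, at most \<open>16 * q ^ k / q\<close> points are lost. This is at most
      \<open>q ^ k\<close> as \<open>q\<close> is at least 16, so \<open>3 * q ^ k\<close> image
      points remain, just what the factor 3 in \<open>large\<close> needs.\<close>
    obtain E' where E': "E' \<subseteq> E" "card E' = 4 * q ^ k"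
      using obtain_subset_with_card_n[of "4 * q ^ k" E] assms(5) by auto
    obtain A :: "'a ^ 'd ^ 'd" where A: "A \<in> coordinate_subspace I"
      and coll: "CARD('a) ^ card I * (card E' - card ((*v) A ` E')) \<le> card E' ^ 2"
      using exists_matrix_few_collisions[of I E'] by blast
    let ?V = "coordinate_subspace I :: ('a ^ 'd) set"
    let ?F = "(*v) A ` E'"
    have card_V: "card ?V = q * q ^ k"
      using I assms(2) by (simp add: card_coordinate_subspace)
    have "q ^ k * (q * (4 * q ^ k - card ?F)) \<le> q ^ k * (16 * q ^ k)"
      using coll unfolding I assms(2) E'(2) by (simp add: power2_eq_square mult_ac)
    then have "q * (4 * q ^ k - card ?F) \<le> 16 * q ^ k"
      using q by simp
    also have "\<dots> \<le> q * q ^ k"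
      using False by simp
    finally have F: "3 * q ^ k \<le> card ?F"
      using q by simp
    have "q * 2 \<le> q * q ^ k"
      using q assms(4) self_le_power[of q k] by (intro mult_left_mono) auto
    then have V_ge: "4 \<le> card ?V"
      using q card_V by linarith
    have "q * (3 * q ^ k) \<le> q * card ?F"
      using F by (rule mult_left_mono) simp
    then have large: "3 * card ?V \<le> CARD('a) * card ?F"
      unfolding card_V assms(2) by (simp add: mult_ac)
    have "?F \<subseteq> ?V"
      using A by (auto simp: coordinate_subspace_def matrix_vector_mult_def)
    from exists_many_secant_directions[OF subspace_coordinate_subspace this V_ge large]
    obtain y where y: "y \<in> E'" "card ?V \<le> 4 * card (secant_directions (A *v y) ?F)"
      by blast
    \<comment> \<open>The extra factor \<open>q\<close> in the size of the subspace cancels against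
      the \<open>q\<close> scalars per line.\<close>
    have "q * q ^ k \<le> 4 * (q * card (radial_image y E'))"
      using y(2) card_secant_directions_image_le[of A y E'] unfolding card_V assms(2)
      by linarith
    then have "q * q ^ k \<le> q * (4 * card (radial_image y E'))"
      by (simp add: mult_ac)
    then have "q ^ k \<le> 4 * card (radial_image y E')"
      using q by simp
    also have "card (radial_image y E') \<le> card (radial_image y E)"
      unfolding radial_image_def using E'(1) by (intro card_mono) auto
    finally show ?thesis using y(1) E'(1) by auto
  qed
  then obtain y where "y \<in> E" "q ^ k \<le> 4 * card (radial_image y E)" by blast
  moreover from this(2) have "real (q ^ k) \<le> real (4 * card (radial_image y E))"
    by (rule of_nat_mono)
  ultimately show ?thesis by (intro bexI[of _ y]) auto
qed

end
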